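(* Let $T$ be a tree on $p$ vertices with $k$ pendant vertices and diameter $d$. Then $$W_\epsilon(T)\leq\frac{k\,\varepsilon^*(T)+dk(p-k-1)-k(p-k)}{2}.$$ Moreover, equality holds if $T\cong K_{1,p-1}$.
   Context: For a connected graph $T$ with vertices $v_1,\ldots,v_p$, $d(v_i,v_j)$ is the distance and $e(v_i)=\max_j d(v_i,v_j)$ the eccentricity. The eccentricity matrix $\epsilon(T)$ has $(i,j)$ entry $d(v_i,v_j)$ if $d(v_i,v_j)=\min\{e(v_i),e(v_j)\}$ and $0$ otherwise. $W_\epsilon(T)=\frac12\sum_{i,j}(\epsilon(T))_{ij}$ and $\varepsilon^*(T)=\sum_i e(v_i)$. A pendant vertex is a vertex of degree $1$. *)

theory Defs
  imports Complex_Main "Graph_Theory.Graph_Theory"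
begin

text \<open>
  A finite simple graph is a symmetric digraph in the sense of the locale \<^locale>\<open>graph\<close>:
  finite, without loops or parallel arcs, every edge being represented by a pair of opposite
  arcs. All graph parameters below take the graph as an explicit argument.
\<close>

text \<open>
  The library predicates \<open>forest\<close> and \<open>tree\<close> forbid all directed cycles. In a symmetric digraph
  every edge gives a directed cycle of length 2, so \<open>tree\<close> would only admit the one-vertex graph
  here. A cycle of the undirected graph is a directed cycle of length at least 3. The library
  predicate \<open>connected\<close> includes that there is at least one vertex.
\<close>

definition undirected_tree :: "('a, 'b) pre_digraph \<Rightarrow> bool" where
  "undirected_tree T \<longleftrightarrow>
     graph T \<and> Digraph_Component.connected T \<and>
     \<not> (\<exists>c. pre_digraph.cycle T c \<and> length c \<ge> 3)"

definition graph_dist :: "('a, 'b) pre_digraph \<Rightarrow> 'a \<Rightarrow> 'a \<Rightarrow> nat" where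
  "graph_dist T u v = (LEAST n. \<exists>w. pre_digraph.awalk T u w v \<and> length w = n)"

text \<open>This is the library's shortest-path distance for unit arc weights.\<close>

lemma graph_dist_eq_mu:
  assumes "wf_digraph T" and "u \<rightarrow>\<^sup>*\<^bsub>T\<^esub> v"
  shows "wf_digraph.\<mu> T (\<lambda>_. 1) u v = ereal (real (graph_dist T u v))"
proof -
  interpret wf_digraph T by (rule assms(1))
  let ?P = "\<lambda>n. \<exists>w. awalk u w v \<and> length w = n"
  have cost: "awalk_cost (\<lambda>_. 1) w = real (length w)" for w
    by (induction w) auto
  obtain w where "awalk u w v"
    using assms(2) reachable_awalk by blast
  hence "?P (length w)" by blast
  hence attained: "?P (graph_dist T u v)"
    unfolding graph_dist_def by (rule LeastI)
  have least: "graph_dist T u v \<le> length w" if "awalk u w v" for w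
    unfolding graph_dist_def using that by (blast intro: Least_le)
  from attained obtain w\<^sub>0 where w\<^sub>0: "awalk u w\<^sub>0 v" "length w\<^sub>0 = graph_dist T u v"
    by blast
  show ?thesis
    unfolding \<mu>_def
  proof (rule antisym)
    show "(INF w\<in>{w. awalk u w v}. ereal (awalk_cost (\<lambda>_. 1) w)) \<le> ereal (real (graph_dist T u v))"
      using w\<^sub>0 by (intro INF_lower2[of w\<^sub>0]) (auto simp: cost)
    show "ereal (real (graph_dist T u v)) \<le> (INF w\<in>{w. awalk u w v}. ereal (awalk_cost (\<lambda>_. 1) w))"
      using least by (intro INF_greatest) (auto simp: cost)
  qed
qed

definition eccentricity :: "('a, 'b) pre_digraph \<Rightarrow> 'a \<Rightarrow> nat" where
  "eccentricity T v = Max (graph_dist T v ` verts T)"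

definition graph_diameter :: "('a, 'b) pre_digraph \<Rightarrow> nat" where
  "graph_diameter T = Max (eccentricity T ` verts T)"

text \<open>The matrix is indexed by the vertices themselves; only entries at vertices of \<open>T\<close> matter.\<close>

definition eccentricity_matrix :: "('a, 'b) pre_digraph \<Rightarrow> 'a \<Rightarrow> 'a \<Rightarrow> real" where
  "eccentricity_matrix T u v =
     (if graph_dist T u v = min (eccentricity T u) (eccentricity T v)
      then real (graph_dist T u v) else 0)"

definition eccentricity_wiener :: "('a, 'b) pre_digraph \<Rightarrow> real" where
  "eccentricity_wiener T =
     1 / 2 * (\<Sum>u\<in>verts T. \<Sum>v\<in>verts T. eccentricity_matrix T u v)"

definition total_eccentricity :: "('a, 'b) pre_digraph \<Rightarrow> nat" where
  "total_eccentricity T = (\<Sum>v\<in>verts T. eccentricity T v)"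

text \<open>
  In the symmetric digraph the out-degree of a vertex is its degree in the undirected graph.
\<close>

definition pendant_vertices :: "('a, 'b) pre_digraph \<Rightarrow> 'a set" where
  "pendant_vertices T = {v \<in> verts T. out_degree T v = 1}"

end

theory Submission
  imports Defs
begin

text \<open>
  A vertex farthest from some other vertex is pendant, for otherwise it would lie on a cycle.
  Hence every nonzero entry of the eccentricity matrix meets the row or column of a pendant
  vertex, and a nonpendant vertex has eccentricity at most \<open>d - 1\<close>. The entry at \<open>(u, v)\<close> is at
  most \<open>e(v)\<close>, and the zero on the diagonal improves the resulting bound on the part of a pendant
  row lying in the pendant columns by \<open>d\<close>. Summing over the pendant rows, with the entries in
  nonpendant columns counted twice by symmetry, gives the bound.
\<close>

section \<open>Walk distance in directed and symmetric digraphs\<close>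

lemma (in wf_digraph) graph_dist_le_length:
  "awalk u p v \<Longrightarrow> graph_dist G u v \<le> length p"
  unfolding graph_dist_def by (blast intro: Least_le)

text \<open>Reachability makes the set of walk lengths nonempty, so the \<open>LEAST\<close> in
  \<open>graph_dist\<close> is attained. Without it the value of \<open>graph_dist\<close> carries
  no information, which is why later facts on small distances also ask for reachability.\<close>

lemma (in wf_digraph) shortest_awalk:
  assumes "u \<rightarrow>\<^sup>* v"
  obtains p where "awalk u p v" "length p = graph_dist G u v"
proof -
  let ?P = "\<lambda>n. \<exists>p. awalk u p v \<and> length p = n"
  from assms obtain p where "awalk u p v"
    using reachable_awalk by blast
  hence "?P (length p)" by blast
  hence "?P (graph_dist G u v)"
    unfolding graph_dist_def by (rule LeastI)
  with that show ?thesis by blast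
qed

lemma (in wf_digraph) graph_dist_self [simp]: "u \<in> verts G \<Longrightarrow> graph_dist G u u = 0"
  using graph_dist_le_length[of u "[]" u] by (simp add: awalk_simps)

lemma (in wf_digraph) graph_dist_adj_le: 
  assumes "u \<rightarrow> v" shows "graph_dist G u v \<le> 1"
proof -
  from assms obtain e where "e \<in> arcs G" "tail G e = u" "head G e = v"
    by (auto simp: arcs_ends_conv)
  hence "awalk u [e] v" by (auto simp: awalk_simps)
  from graph_dist_le_length[OF this] show ?thesis by simp
qed

lemma (in wf_digraph) graph_dist_eq_0D: 
  assumes "u \<rightarrow>\<^sup>* v" "graph_dist G u v = 0"
  shows "u = v"
  using assms shortest_awalk by (metis awalk_empty_ends length_0_conv)

lemma (in wf_digraph) graph_dist_eq_1D: 
  assumes "u \<rightarrow>\<^sup>* v" "graph_dist G u v = 1"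
  shows "u \<rightarrow> v"
proof -
  from shortest_awalk[OF assms(1)] assms(2) obtain e where "awalk u [e] v"
    by (metis One_nat_def length_0_conv length_Suc_conv)
  thus ?thesis by (auto simp: awalk_simps in_arcs_imp_in_arcs_ends)
qed

lemma (in sym_digraph) awalk_reverse:
  "awalk u p v \<Longrightarrow> \<exists>q. awalk v q u \<and> length q = length p"
proof (induction p arbitrary: u)
  case Nil
  thus ?case by (auto simp: awalk_simps)
next
  case (Cons e p)
  hence e: "e \<in> arcs G" "u = tail G e" "awalk (head G e) p v"
    by (auto simp: awalk_simps)
  from Cons.IH[OF e(3)] obtain q where q: "awalk v q (head G e)" "length q = length p"
    by blast
  from e(1) obtain f where f: "f \<in> arcs G" "tail G f = head G e" "head G f = tail G e"
    using sym_arcs unfolding symmetric_conv by metis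
  have "awalk v (q @ [f]) u"
    using q f e by (intro awalk_appendI[OF q(1)]) (auto simp: awalk_simps)
  with q show ?case by (intro exI[of _ "q @ [f]"]) auto
qed

lemma (in sym_digraph) graph_dist_commute: "graph_dist G u v = graph_dist G v u"
proof -
  have "(\<exists>p. awalk u p v \<and> length p = n) \<longleftrightarrow> (\<exists>p. awalk v p u \<and> length p = n)" for n
    using awalk_reverse by metis
  thus ?thesis unfolding graph_dist_def by simp
qed

section \<open>Vertex deletion and cycles through a vertex\<close>

lemma (in wf_digraph) reachable_del_vertI:
  assumes "awalk u p v" "x \<notin> set (awalk_verts u p)"
  shows "u \<rightarrow>\<^sup>*\<^bsub>del_vert x\<^esub> v"
proof -
  interpret D: wf_digraph "del_vert x" by (rule wf_digraph_del_vert)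
  from assms have "D.awalk u p v"
  proof (induction p arbitrary: u)
    case Nil
    thus ?case by (auto simp: awalk_simps D.awalk_simps del_vert_simps)
  next
    case (Cons e p)
    hence e: "e \<in> arcs G" "u = tail G e" "awalk (head G e) p v"
      by (auto simp: awalk_simps)
    with Cons.prems have x: "tail G e \<noteq> x" "x \<notin> set (awalk_verts (head G e) p)"
      by auto
    with e hd_in_awalk_verts(1)[OF e(3)] have "head G e \<noteq> x" by auto
    with e x Cons.IH[OF e(3)] show ?case
      by (auto simp: D.awalk_simps del_vert_simps)
  qed
  thus ?thesis by (rule D.reachable_awalkI)
qed

text \<open>Takes a connection in the smaller digraph back to \<open>G\<close>. A path rather than a
  walk is extracted because the vertices of a cycle must be distinct.\<close>

lemma (in wf_digraph) apath_of_reachable_del_vert: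
  assumes "u \<rightarrow>\<^sup>*\<^bsub>del_vert x\<^esub> v"
  obtains p where "apath u p v" "x \<notin> set (awalk_verts u p)"
proof -
  interpret D: wf_digraph "del_vert x" by (rule wf_digraph_del_vert)
  from assms obtain p where p: "D.apath u p v"
    using D.reachable_awalk D.apath_awalk_to_apath by blast
  have sub: "subgraph (del_vert x) G" by (rule subgraph_del_vert)
  have "set (D.awalk_verts u p) \<subseteq> verts (del_vert x)"
    using p by (auto simp: D.apath_def)
  hence "x \<notin> set (D.awalk_verts u p)" by (auto simp: del_vert_simps)
  thus ?thesis using p sub
    by (intro that[of p]) 
      (auto simp: compatible_awalk_verts D.apath_def apath_def dest: subgraph_awalk_imp_awalk)
qed

lemma (in sym_digraph) symmetric_del_vert: "symmetric (del_vert x)"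
  using sym_arcs unfolding symmetric_conv del_vert_simps by fastforce

text \<open>The arcs \<open>e\<close> and \<open>f\<close> join \<open>v\<close> to the two ends of
  the path. Since the path is simple and misses \<open>v\<close>, no vertex is repeated except at
  the closing point.\<close>

lemma (in wf_digraph) cycle_through_vertex:
  assumes "e \<in> arcs G" "tail G e = v" "f \<in> arcs G" "head G f = v"
    and "apath (head G e) p (tail G f)" "v \<notin> set (awalk_verts (head G e) p)"
  shows "cycle (e # p @ [f])"
proof -
  have w: "awalk (head G e) (p @ [f]) v"
    using assms by (intro awalk_appendI) (auto simp: apath_def awalk_simps)
  have "awalk_verts (head G e) (p @ [f]) = awalk_verts (head G e) p @ [v]"
    using awalk_verts_append[OF w] assms by auto
  with w assms show ?thesis
    unfolding cycle_def by (intro exI[of _ v]) (auto simp: awalk_Cons_iff apath_def)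
qed

text \<open>The piece of \<open>p\<close> from \<open>u\<close> up to \<open>v\<close> already has
  length at least \<open>graph_dist G u v\<close>, so nothing can follow it. In contrapositive form:
  a walk from \<open>u\<close> of at most this length that ends elsewhere avoids
  \<open>v\<close>.\<close>

lemma (in wf_digraph) graph_dist_less_of_on_shortest:
  assumes "awalk u p x" "length p \<le> graph_dist G u v" "v \<in> set (awalk_verts u p)"
  shows "x = v"
proof -
  from awalk_decomp[OF assms(1,3)] obtain q r where
    qr: "p = q @ r" "awalk u q v" "awalk v r x" by blast
  have "length r \<le> 0"
    using graph_dist_le_length[OF qr(2)] assms(2) unfolding qr(1) length_append by linarith
  with qr show ?thesis by (simp add: awalk_simps)
qed

text \<open>If \<open>v\<close> had two neighbours, shortest walks from \<open>u\<close> to both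
  would avoid \<open>v\<close>, because neither neighbour is farther from \<open>u\<close> than
  \<open>v\<close> is. The neighbours would then be joined by a path outside \<open>v\<close>, and
  this path closes up to a cycle through \<open>v\<close>.\<close>

lemma (in graph) unique_neighbor_of_farthest:
  assumes acyclic: "\<not> (\<exists>c. cycle c \<and> length c \<ge> 3)"
    and conn: "\<And>x. x \<in> verts G \<Longrightarrow> u \<rightarrow>\<^sup>* x"
    and far: "\<And>x. x \<in> verts G \<Longrightarrow> graph_dist G u x \<le> graph_dist G u v"
    and v: "v \<in> verts G" "u \<noteq> v"
  shows "out_degree G v = 1"
proof -
  from shortest_awalk[OF conn[OF v(1)]]
  obtain p where p: "awalk u p v" "length p = graph_dist G u v" .
  with v(2) have "p \<noteq> []" by (auto simp: awalk_simps)
  \<comment> \<open>The last arc of a shortest walk to \<open>v\<close> supplies the neighbour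
    \<open>w\<close> that will turn out to be the only one.\<close>
  then obtain q g where pq: "p = q @ [g]" by (cases p rule: rev_cases) auto
  define w where "w = tail G g"
  from p(1) pq have q: "awalk u q w" and g: "g \<in> arcs G" "head G g = v"
    by (auto simp: awalk_simps w_def)
  have wv: "w \<noteq> v" using no_loops[OF g(1)] g(2) by (simp add: w_def)
  have "v \<notin> set (awalk_verts u q)"
    using graph_dist_less_of_on_shortest[OF q, of v] p(2) pq wv by auto
  hence uw: "u \<rightarrow>\<^sup>*\<^bsub>del_vert v\<^esub> w" by (rule reachable_del_vertI[OF q])
  from g(1) obtain e where e: "e \<in> arcs G" "tail G e = v" "head G e = w"
    using sym_arcs g unfolding symmetric_conv w_def by metis
  have "e' = e" if e': "e' \<in> arcs G" "tail G e' = v" for e'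
  proof (rule ccontr)
    assume "e' \<noteq> e"
    \<comment> \<open>Without parallel arcs, a second arc out of \<open>v\<close> leads to a second
      neighbour.\<close>
    with no_multi_arcs[OF e'(1) e(1)] e e' have neq: "head G e' \<noteq> w"
      by (auto simp: arc_to_ends_def)
    define x where "x = head G e'"
    have x: "x \<in> verts G" "x \<noteq> v" using e' no_loops[OF e'(1)] by (auto simp: x_def)
    from shortest_awalk[OF conn[OF x(1)]]
    obtain r where r: "awalk u r x" "length r = graph_dist G u x" .
    have "v \<notin> set (awalk_verts u r)"
      using graph_dist_less_of_on_shortest[OF r(1), of v] r(2) far[OF x(1)] x(2) by auto
    hence ux: "u \<rightarrow>\<^sup>*\<^bsub>del_vert v\<^esub> x" by (rule reachable_del_vertI[OF r(1)])
    interpret D: wf_digraph "del_vert v" by (rule wf_digraph_del_vert)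
    \<comment> \<open>The connection runs from \<open>x\<close> back to \<open>u\<close> and on to
      \<open>w\<close>, all outside \<open>v\<close>.\<close>
    have "x \<rightarrow>\<^sup>*\<^bsub>del_vert v\<^esub> w"
      using symmetric_reachable[OF symmetric_del_vert ux] uw by (rule D.reachable_trans)
    then obtain s where s: "apath x s w" "v \<notin> set (awalk_verts x s)"
      by (rule apath_of_reachable_del_vert)
    \<comment> \<open>A nonempty \<open>s\<close> makes the cycle at least 3 arcs long, so it is not
      just an edge traversed back and forth.\<close>
    have "s \<noteq> []" using s(1) neq by (auto simp: x_def apath_simps)
    moreover have "cycle (e' # s @ [g])"
      using cycle_through_vertex[of e' v g s] e' g s by (auto simp: x_def w_def)
    ultimately show False
      using acyclic by (cases s) force+
  qed
  with e have "out_arcs G v = {e}" unfolding out_arcs_def by blast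
  thus ?thesis by (simp add: out_degree_def)
qed


section \<open>Eccentricities, diameter and the eccentricity matrix\<close>

lemma (in fin_digraph) graph_dist_le_eccentricity:
  "v \<in> verts G \<Longrightarrow> graph_dist G u v \<le> eccentricity G u"
  by (simp add: eccentricity_def)

lemma (in fin_digraph) eccentricity_attained:
  assumes "verts G \<noteq> {}"
  obtains v where "v \<in> verts G" "graph_dist G u v = eccentricity G u"
proof -
  have "eccentricity G u \<in> graph_dist G u ` verts G"
    unfolding eccentricity_def using assms by (intro Max_in) auto
  thus ?thesis using that by force
qed

lemma (in fin_digraph) eccentricity_le_diameter:
  "v \<in> verts G \<Longrightarrow> eccentricity G v \<le> graph_diameter G"
  by (simp add: graph_diameter_def)

lemma (in fin_digraph) diameter_attained:
  assumes "verts G \<noteq> {}"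
  obtains v where "v \<in> verts G" "eccentricity G v = graph_diameter G"
proof -
  have "graph_diameter G \<in> eccentricity G ` verts G"
    unfolding graph_diameter_def using assms by (intro Max_in) auto
  thus ?thesis using that by force
qed

lemma eccentricity_matrix_le:
  "eccentricity_matrix T u v \<le> eccentricity T u" "eccentricity_matrix T u v \<le> eccentricity T v"
  by (auto simp: eccentricity_matrix_def)

lemma (in sym_digraph) eccentricity_matrix_commute:
  "eccentricity_matrix G u v = eccentricity_matrix G v u"
  by (simp add: eccentricity_matrix_def graph_dist_commute[of u v] min.commute)

lemma (in wf_digraph) eccentricity_matrix_diag:
  "u \<in> verts G \<Longrightarrow> eccentricity_matrix G u u = 0"
  by (simp add: eccentricity_matrix_def)

section \<open>Pendant vertices and eccentricities in a tree\<close>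

lemma undirected_tree_graph: "undirected_tree T \<Longrightarrow> graph T"
  by (simp add: undirected_tree_def)

text \<open>\<open>connected\<close> disregards the direction of arcs; in a symmetric digraph this
  already gives strong connectedness.\<close>

lemma undirected_tree_reachable:
  assumes "undirected_tree T" "u \<in> verts T" "v \<in> verts T"
  shows "u \<rightarrow>\<^sup>*\<^bsub>T\<^esub> v"
proof -
  interpret graph T using assms(1) by (rule undirected_tree_graph)
  have "strongly_connected T"
    using assms(1) sym_arcs unfolding undirected_tree_def
    by (intro symmetric_connected_imp_strongly_connected) auto
  with assms(2,3) show ?thesis by (auto simp: strongly_connected_def)
qed

lemma undirected_tree_nonempty: "undirected_tree T \<Longrightarrow> verts T \<noteq> {}"
  by (auto simp: undirected_tree_def Digraph_Component.connected_def strongly_connected_def)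

lemma farthest_is_pendant:
  assumes T: "undirected_tree T" and uv: "u \<in> verts T" "v \<in> verts T" "u \<noteq> v"
    and far: "graph_dist T u v = eccentricity T u"
  shows "v \<in> pendant_vertices T"
proof -
  interpret graph T using T by (rule undirected_tree_graph)
  have "out_degree T v = 1"
    using T uv undirected_tree_reachable[OF T uv(1)] graph_dist_le_eccentricity[of _ u] far
    by (intro unique_neighbor_of_farthest[of u v]) (auto simp: undirected_tree_def)
  with uv show ?thesis by (simp add: pendant_vertices_def)
qed

text \<open>The minimum in the matrix is \<open>e(u)\<close> or \<open>e(v)\<close>, so a nonzero
  entry makes one of the two vertices farthest from the other and hence pendant.\<close>

lemma eccentricity_matrix_nonpendant_eq_0:
  assumes T: "undirected_tree T" and "u \<in> verts T" "v \<in> verts T"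
    and "u \<notin> pendant_vertices T" "v \<notin> pendant_vertices T"
  shows "eccentricity_matrix T u v = 0"
proof (cases "u = v")
  case True
  interpret graph T using T by (rule undirected_tree_graph)
  show ?thesis using True assms by (simp add: eccentricity_matrix_diag)
next
  case False
  interpret graph T using T by (rule undirected_tree_graph)
  from False assms have "graph_dist T u v \<noteq> eccentricity T u" "graph_dist T v u \<noteq> eccentricity T v"
    using farthest_is_pendant[OF T] by blast+
  thus ?thesis
    by (auto simp: eccentricity_matrix_def min_def graph_dist_commute[of u v])
qed

text \<open>Both ends of a diametral pair have eccentricity \<open>d\<close>, and an end that is
  farthest from the other is pendant. The second vertex of \<open>T\<close> ensures that the ends
  differ.\<close>

lemma pendant_diametral_vertex:
  assumes T: "undirected_tree T" and "card (verts T) \<ge> 2"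
  obtains a where "a \<in> pendant_vertices T" "eccentricity T a = graph_diameter T"
proof -
  interpret graph T using T by (rule undirected_tree_graph)
  note ne = undirected_tree_nonempty[OF T]
  from diameter_attained[OF ne]
  obtain b where b: "b \<in> verts T" "eccentricity T b = graph_diameter T" .
  from eccentricity_attained[OF ne]
  obtain a where a: "a \<in> verts T" "graph_dist T b a = eccentricity T b" .
  have "\<not> verts T \<subseteq> {b}"
    using assms(2) card_mono[of "{b}" "verts T"] by auto
  then obtain x where x: "x \<in> verts T" "x \<noteq> b" by blast
  have "graph_dist T b x \<noteq> 0"
    using graph_dist_eq_0D[of b x] undirected_tree_reachable[OF T b(1) x(1)] x by auto
  with graph_dist_le_eccentricity[OF x(1), of b] a b have "b \<noteq> a" by auto
  with farthest_is_pendant[OF T b(1) a(1)] a have "a \<in> pendant_vertices T" by simp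
  moreover have "eccentricity T a = graph_diameter T"
    using graph_dist_le_eccentricity[OF b(1), of a] eccentricity_le_diameter[OF a(1)] a b
    by (simp add: graph_dist_commute[of a b])
  ultimately show ?thesis using that by blast
qed

text \<open>If \<open>v\<close> had eccentricity \<open>d\<close>, a vertex \<open>x\<close> at
  distance \<open>d\<close> from \<open>v\<close> would have eccentricity \<open>d\<close> as well.
  Then \<open>v\<close> would be farthest from \<open>x\<close> and therefore pendant.\<close>

lemma eccentricity_nonpendant_less:
  assumes T: "undirected_tree T" and "card (verts T) \<ge> 2"
    and v: "v \<in> verts T" "v \<notin> pendant_vertices T"
  shows "eccentricity T v < graph_diameter T"
proof (rule ccontr)
  interpret graph T using T by (rule undirected_tree_graph)
  assume "\<not> ?thesis"
  with eccentricity_le_diameter[OF v(1)] have ev: "eccentricity T v = graph_diameter T" by simp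
  from eccentricity_attained[OF undirected_tree_nonempty[OF T]]
  obtain x where x: "x \<in> verts T" "graph_dist T v x = eccentricity T v" .
  have "x \<noteq> v"
  proof
    assume "x = v"
    with x ev have "graph_diameter T = 0" by simp
    hence "graph_dist T v y = 0" if "y \<in> verts T" for y
      using graph_dist_le_eccentricity[OF that, of v] ev by simp
    hence "verts T \<subseteq> {v}"
      using graph_dist_eq_0D undirected_tree_reachable[OF T v(1)] by blast
    with card_mono[of "{v}" "verts T"] assms(2) show False by auto
  qed
  moreover have "graph_dist T x v = eccentricity T x"
    using graph_dist_le_eccentricity[OF v(1), of x] eccentricity_le_diameter[OF x(1)] x ev
    by (simp add: graph_dist_commute[of x v])
  ultimately have "v \<in> pendant_vertices T"
    using farthest_is_pendant[OF T x(1) v(1)] by simp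
  with v(2) show False by simp
qed

section \<open>The upper bound for trees with at least two vertices\<close>

text \<open>The pendant block contributes the correction \<open>- k * d\<close> and the two mixed
  blocks contribute \<open>k * (p - k) * (d - 1)\<close>. Their sum is
  \<open>d * k * (p - k - 1) - k * (p - k)\<close>.\<close>

lemma eccentricity_wiener_le:
  assumes T: "undirected_tree T" and p2: "card (verts T) \<ge> 2"
  defines "p \<equiv> real (card (verts T))" and "k \<equiv> real (card (pendant_vertices T))"
    and "d \<equiv> real (graph_diameter T)"
  shows "2 * eccentricity_wiener T \<le>
    k * real (total_eccentricity T) + d * k * (p - k - 1) - k * (p - k)"
proof -
  interpret graph T using T by (rule undirected_tree_graph)
  let ?P = "pendant_vertices T"
  define Q where "Q = verts T - ?P"
  let ?m = "eccentricity_matrix T"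
  let ?e = "\<lambda>v. real (eccentricity T v)"
  have PV: "?P \<subseteq> verts T" by (auto simp: pendant_vertices_def)
  hence finP: "finite ?P" and finQ: "finite Q" 
    using finite_subset[OF PV finite_verts] by (auto simp: Q_def)
  have split: "(\<Sum>v\<in>verts T. f v) = (\<Sum>v\<in>?P. f v) + (\<Sum>v\<in>Q. f v)" for f :: "_ \<Rightarrow> real"
    unfolding Q_def using PV by (subst add.commute) (simp add: sum.subset_diff)
  have cardQ: "real (card Q) = p - k"
    unfolding Q_def p_def k_def using PV finP card_mono[of "verts T" ?P]
    by (simp add: card_Diff_subset of_nat_diff)
  from pendant_diametral_vertex[OF T p2] obtain a
    where a: "a \<in> ?P" "eccentricity T a = graph_diameter T" .

  \<comment> \<open>The diagonal zero saves only \<open>e(u)\<close>, but the entry in column \<open>a\<close> is also at most \<open>e(u)\<close>,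
    so that in total \<open>e(a) = d\<close> is saved.\<close>
  have row: "(\<Sum>v\<in>?P. ?m u v) \<le> (\<Sum>v\<in>?P. ?e v) - d" if u: "u \<in> ?P" for u
  proof -
    have diag: "?m u u = 0" using u PV by (auto intro: eccentricity_matrix_diag)
    have "(\<Sum>v\<in>?P. ?m u v) \<le> (\<Sum>v\<in>?P-{a}. ?e v)"
    proof (cases "u = a")
      case True
      hence "(\<Sum>v\<in>?P. ?m u v) = (\<Sum>v\<in>?P-{a}. ?m u v)"
        using a(1) diag finP by (simp add: sum.remove)
      also have "\<dots> \<le> (\<Sum>v\<in>?P-{a}. ?e v)"
        by (intro sum_mono eccentricity_matrix_le)
      finally show ?thesis .
    next
      case False
      with u have ua: "u \<in> ?P - {a}" by simp
      have "(\<Sum>v\<in>?P. ?m u v) = ?m u a + (\<Sum>v\<in>?P-{a}-{u}. ?m u v)"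
        using finP a(1) sum.remove[OF _ ua, of "?m u"] diag by (simp add: sum.remove)
      also have "\<dots> \<le> ?e u + (\<Sum>v\<in>?P-{a}-{u}. ?e v)"
        by (intro add_mono sum_mono eccentricity_matrix_le)
      also have "\<dots> = (\<Sum>v\<in>?P-{a}. ?e v)"
        using finP ua by (simp add: sum.remove[OF _ ua])
      finally show ?thesis .
    qed
    also have "\<dots> = (\<Sum>v\<in>?P. ?e v) - d"
      using a finP by (simp add: sum_diff1 d_def)
    finally show ?thesis .
  qed
  have PP: "(\<Sum>u\<in>?P. \<Sum>v\<in>?P. ?m u v) \<le> k * ((\<Sum>v\<in>?P. ?e v) - d)"
    using sum_bounded_above[of ?P "\<lambda>u. \<Sum>v\<in>?P. ?m u v"] row by (simp add: k_def)

  \<comment> \<open>Of the two copies of a mixed entry, one is charged to \<open>e(v)\<close> and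
    the other to \<open>d - 1\<close>, which bounds \<open>e(v)\<close> for nonpendant
    \<open>v\<close>.\<close>
  have entry: "2 * ?m u v \<le> ?e v + (d - 1)" if "v \<in> Q" for u v
  proof -
    have "eccentricity T v < graph_diameter T"
      using that eccentricity_nonpendant_less[OF T p2] by (auto simp: Q_def)
    hence "?e v \<le> d - 1" by (simp add: d_def)
    with eccentricity_matrix_le(2)[of T u v] show ?thesis by simp
  qed
  have PQ: "2 * (\<Sum>u\<in>?P. \<Sum>v\<in>Q. ?m u v) \<le> k * ((\<Sum>v\<in>Q. ?e v) + (p - k) * (d - 1))"
  proof -
    have "2 * (\<Sum>v\<in>Q. ?m u v) \<le> (\<Sum>v\<in>Q. ?e v) + (p - k) * (d - 1)" (is "_ \<le> ?B") for u
      using sum_mono[of Q "\<lambda>v. 2 * ?m u v" "\<lambda>v. ?e v + (d - 1)"] entry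
      by (simp add: sum.distrib sum_distrib_left cardQ)
    hence "(\<Sum>u\<in>?P. 2 * (\<Sum>v\<in>Q. ?m u v)) \<le> real (card ?P) * ?B"
      by (intro sum_bounded_above)
    thus ?thesis
      by (simp only: sum_distrib_left[symmetric] k_def)
  qed
  have QP: "(\<Sum>u\<in>Q. \<Sum>v\<in>?P. ?m u v) = (\<Sum>u\<in>?P. \<Sum>v\<in>Q. ?m u v)"
    by (subst sum.swap) (simp add: eccentricity_matrix_commute)
  have QQ: "(\<Sum>u\<in>Q. \<Sum>v\<in>Q. ?m u v) = 0"
    using eccentricity_matrix_nonpendant_eq_0[OF T] by (intro sum.neutral ballI) (auto simp: Q_def)
  have "2 * eccentricity_wiener T = (\<Sum>u\<in>?P. \<Sum>v\<in>?P. ?m u v) + 2 * (\<Sum>u\<in>?P. \<Sum>v\<in>Q. ?m u v)"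
    by (simp add: eccentricity_wiener_def split sum.distrib QP QQ)
  also have "\<dots> \<le> k * ((\<Sum>v\<in>?P. ?e v) - d) + k * ((\<Sum>v\<in>Q. ?e v) + (p - k) * (d - 1))"
    by (intro add_mono PP PQ)
  also have "\<dots> = k * real (total_eccentricity T) + d * k * (p - k - 1) - k * (p - k)"
    by (simp add: total_eccentricity_def split algebra_simps)
  finally show ?thesis .
qed

section \<open>Equality for stars\<close>

text \<open>Allows degrees in a star to be read off from \<open>arcs_ends\<close>, which is all that
  the complete bipartite structure specifies about the arcs.\<close>

lemma (in nomulti_digraph) out_degree_eq_card_neighbors:
  "out_degree G v = card {w. v \<rightarrow> w}"
proof -
  have "inj_on (head G) (out_arcs G v)"
    using no_multi_arcs by (auto simp: inj_on_def arc_to_ends_def)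
  moreover have "head G ` out_arcs G v = {w. v \<rightarrow> w}"
    by (auto simp: arcs_ends_conv)
  ultimately show ?thesis
    unfolding out_degree_def by (metis card_image)
qed

text \<open>Both sides are computed explicitly. The formula is stated in the number \<open>n\<close>
  of leaves, with \<open>n + 1\<close> in place of \<open>p\<close>, to avoid subtraction on
  naturals.\<close>

lemma eccentricity_wiener_star:
  assumes K: "complete_bipartite_digraph 1 n T"
  defines "k \<equiv> real (card (pendant_vertices T))" and "d \<equiv> real (graph_diameter T)"
  shows "2 * eccentricity_wiener T = 
    k * real (total_eccentricity T) + d * k * (real n - k) - k * (real n + 1 - k)"
proof -
  interpret graph T using K by (simp add: complete_bipartite_digraph_def)
  from K obtain c L where V: "verts T = insert c L" "c \<notin> L" and n: "card L = n"
    and A: "arcs_ends T = {c} \<times> L \<union> L \<times> {c}"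
    unfolding complete_bipartite_digraph_def by (auto simp: card_1_singleton_iff)
  have finL: "finite L" using V finite_verts by (metis finite_insert)
  have dcl: "graph_dist T c l = 1" if "l \<in> L" for l
  proof -
    have "c \<rightarrow>\<^bsub>T\<^esub> l" using that A by auto
    with graph_dist_adj_le[OF this] graph_dist_eq_0D[of c l] that V(2) show ?thesis
      by fastforce
  qed
  have dlc: "graph_dist T l c = 1" if "l \<in> L" for l
    using dcl[OF that] by (simp add: graph_dist_commute)
  have dll: "graph_dist T l l' = 2" if l: "l \<in> L" "l' \<in> L" "l \<noteq> l'" for l l'
  proof -
    have "l \<rightarrow>\<^bsub>T\<^esub> c" "c \<rightarrow>\<^bsub>T\<^esub> l'" using l A by auto
    then obtain e f where "e \<in> arcs T" "tail T e = l" "head T e = c" 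
      "f \<in> arcs T" "tail T f = c" "head T f = l'"
      by (auto simp: arcs_ends_conv)
    hence w: "awalk l [e, f] l'" by (auto simp: awalk_simps)
    hence r: "l \<rightarrow>\<^sup>*\<^bsub>T\<^esub> l'" by (rule reachable_awalkI)
    \<comment> \<open>The walk through \<open>c\<close> bounds the distance by 2; distinctness
      excludes 0 and nonadjacency excludes 1.\<close>
    have "\<not> l \<rightarrow>\<^bsub>T\<^esub> l'" using l A V(2) by auto
    with graph_dist_eq_0D[OF r] graph_dist_eq_1D[OF r] graph_dist_le_length[OF w] l(3)
    show ?thesis by fastforce
  qed
  have self: "graph_dist T x x = 0" if "x \<in> insert c L" for x
    using that V(1) by simp
  have deg_leaf: "out_degree T l = 1" if "l \<in> L" for l
  proof -
    have "{w. l \<rightarrow>\<^bsub>T\<^esub> w} = {c}" using that A V(2) by auto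
    thus ?thesis by (simp add: out_degree_eq_card_neighbors)
  qed
  have deg_c: "out_degree T c = n"
  proof -
    have "{w. c \<rightarrow>\<^bsub>T\<^esub> w} = L" using A V(2) by auto
    thus ?thesis by (simp add: out_degree_eq_card_neighbors n)
  qed
  \<comment> \<open>The small cases are degenerate: for \<open>n = 0\<close> there is no pendant
    vertex, and for \<open>n = 1\<close> the centre is pendant too and the diameter is 1.\<close>
  consider "n = 0" | "n = 1" | "n \<ge> 2" by linarith
  thus ?thesis
  proof cases
    case 1
    have "L = {}" using 1 n finL by simp
    moreover have "pendant_vertices T = {}"
      using \<open>L = {}\<close> V(1) deg_c 1 by (auto simp: pendant_vertices_def)
    ultimately show ?thesis
      using V(1) by (simp add: eccentricity_wiener_def eccentricity_matrix_diag k_def)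
  next
    case 2
    then obtain l where L: "L = {l}" using n by (auto simp: card_1_singleton_iff)
    have e: "eccentricity T c = 1" "eccentricity T l = 1"
      using V(1) L dcl dlc self by (auto simp: eccentricity_def)
    have "pendant_vertices T = {c, l}"
      using V(1) L deg_c deg_leaf 2 by (auto simp: pendant_vertices_def)
    hence "k = 2" using V(2) L by (auto simp: k_def)
    moreover have "d = 1" using V(1) L e by (simp add: d_def graph_diameter_def)
    moreover have "real (total_eccentricity T) = 2"
      using V L e by (simp add: total_eccentricity_def)
    moreover have "eccentricity_matrix T c l = 1" "eccentricity_matrix T l c = 1"
      using L dcl dlc e by (auto simp: eccentricity_matrix_def)
    hence "2 * eccentricity_wiener T = 2"
      using V L by (simp add: eccentricity_wiener_def eccentricity_matrix_diag)
    ultimately show ?thesis using 2 by simp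
  next
    case 3
    hence "L \<noteq> {}" using n by auto
    have ec: "eccentricity T c = 1"
    proof -
      have "graph_dist T c ` verts T = {0, 1}"
        using V(1) \<open>L \<noteq> {}\<close> dcl self by (auto simp: image_iff)
      thus ?thesis by (simp add: eccentricity_def)
    qed
    have el: "eccentricity T l = 2" if l: "l \<in> L" for l
    proof -
      have "\<not> L \<subseteq> {l}" using 3 n card_mono[of "{l}" L] by auto
      then obtain l' where "l' \<in> L" "l' \<noteq> l" by blast
      hence "L - {l} \<noteq> {}" by blast
      \<comment> \<open>As the image of a constant map on a nonempty set, this collapses to a
        singleton.\<close>
      moreover have "graph_dist T l ` (L - {l}) = (\<lambda>_. 2) ` (L - {l})"
        using dll[OF l] by (intro image_cong) auto
      ultimately have "graph_dist T l ` (L - {l}) = {2}" by (simp only: image_constant_conv if_False)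
      moreover have "verts T = insert c (insert l (L - {l}))" using V(1) l by auto
      ultimately have "graph_dist T l ` verts T = {1, 0, 2}"
        using dlc[OF l] self l by (simp del: insert_Diff_single)
      thus ?thesis by (simp add: eccentricity_def)
    qed
    have P: "pendant_vertices T = L"
      using V deg_c deg_leaf 3 by (auto simp: pendant_vertices_def)
    hence k: "k = n" by (simp add: k_def n)
    have "eccentricity T ` verts T = {1, 2}"
      using V(1) ec el \<open>L \<noteq> {}\<close> by (auto simp: image_iff)
    hence d: "d = 2" by (simp add: d_def graph_diameter_def)
    have tot: "real (total_eccentricity T) = 1 + 2 * n"
      using V finL ec el n by (simp add: total_eccentricity_def)
    have mll: "(\<Sum>v\<in>L. eccentricity_matrix T u v) = 2 * (real n - 1)" if u: "u \<in> L" for u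
    proof -
      have "(\<Sum>v\<in>L. eccentricity_matrix T u v) = (\<Sum>v\<in>L-{u}. eccentricity_matrix T u v)"
        using u finL V(1) by (simp add: sum.remove[of L u] eccentricity_matrix_diag)
      also have "\<dots> = (\<Sum>v\<in>L-{u}. 2)"
        using u el dll by (intro sum.cong) (auto simp: eccentricity_matrix_def)
      also have "\<dots> = 2 * (real n - 1)"
        using u finL n 3 by (simp add: card_Diff_singleton of_nat_diff)
      finally show ?thesis .
    qed
    have mcl: "eccentricity_matrix T c l = 1" "eccentricity_matrix T l c = 1" if "l \<in> L" for l
      using that ec el dcl dlc by (auto simp: eccentricity_matrix_def)
    \<comment> \<open>The row of the centre sums to \<open>n\<close>; each of the \<open>n\<close>
      leaf rows has a 1 in the column of \<open>c\<close> and a 2 for every other leaf.\<close>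
    have "2 * eccentricity_wiener T = real n + real n * (1 + 2 * (real n - 1))"
      using V finL n by (simp add: eccentricity_wiener_def eccentricity_matrix_diag mcl mll)
    thus ?thesis by (simp add: k d tot algebra_simps)
  qed
qed

theorem theorem4p7:
  fixes T :: "('a, 'b) pre_digraph" and p k d :: nat
  assumes "undirected_tree T"
    and "card (verts T) = p"
    and "card (pendant_vertices T) = k"
    and "graph_diameter T = d"
  shows "eccentricity_wiener T \<le>
           (real k * real (total_eccentricity T)
              + real d * real k * (real p - real k - 1)
              - real k * (real p - real k)) / 2 \<and>
         (complete_bipartite_digraph 1 (p - 1) T \<longrightarrow>
           eccentricity_wiener T =
             (real k * real (total_eccentricity T)
                + real d * real k * (real p - real k - 1)
                - real k * (real p - real k)) / 2)"
proof (intro conjI impI)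
  interpret graph T using assms(1) by (rule undirected_tree_graph)
  \<comment> \<open>Needed to read the natural number \<open>p - 1\<close> as a real difference, and
    to leave \<open>p = 1\<close> as the only case below 2.\<close>
  have "p \<ge> 1"
    using assms(2) undirected_tree_nonempty[OF assms(1)] by (auto simp: Suc_le_eq card_gt_0_iff)
  {
    assume "complete_bipartite_digraph 1 (p - 1) T"
    from eccentricity_wiener_star[OF this] \<open>p \<ge> 1\<close> assms
    show "eccentricity_wiener T =
        (real k * real (total_eccentricity T) + real d * real k * (real p - real k - 1)
          - real k * (real p - real k)) / 2"
      by (simp add: of_nat_diff algebra_simps)
  }
  show "eccentricity_wiener T \<le>
      (real k * real (total_eccentricity T) + real d * real k * (real p - real k - 1)
        - real k * (real p - real k)) / 2"
  proof (cases "p \<ge> 2")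
    case True
    with eccentricity_wiener_le[of T] assms show ?thesis by simp
  next
    case False
    with \<open>p \<ge> 1\<close> assms(2) obtain v where v: "verts T = {v}"
      by (auto simp: le_Suc_eq numeral_2_eq_2 not_le less_Suc_eq card_1_singleton_iff)
    \<comment> \<open>On a single vertex every arc would be a loop. Hence \<open>k = 0\<close>, and
      both sides of the bound vanish.\<close>
    have "arcs T = {}"
      using v no_loops head_in_verts tail_in_verts by (metis equals0I singletonD)
    hence "out_arcs T v = {}" by auto
    hence "pendant_vertices T = {}"
      using v by (auto simp: pendant_vertices_def out_degree_def)
    hence "k = 0" using assms(3) by simp
    thus ?thesis using v by (simp add: eccentricity_wiener_def eccentricity_matrix_diag)
  qed
qed

end
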